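(* Let $n=2m$ with $m\ge1$ and let $\mathcal P(2,n)=\{e_i+e_j:1\le i\le j\le n\}\subset\mathbb R^n$, with $e_i+e_j$ identified with the variable $x_{ij}$. Let $\succ$ be a total order of these points in which the anti-diagonal points satisfy $x_{m,m+1}\succ\cdots\succ x_{2,n-1}\succ x_{1n}$ and are smaller than all other points, and the other points are ordered so that $x_{ij}\succ x_{hk}$ whenever $|i-j|<|h-k|$. Then the core of the reverse lexicographic triangulation $\Delta_\succ$ of $\mathcal P(2,n)$ with respect to $\succ$ is an $(m-1)$-dimensional sphere.
   Context: Reverse lexicographic triangulation of $\mathcal A=\{a_1\succ\cdots\succ a_N\}$: if $F_1,\dots,F_k$ are the facets of $\operatorname{conv}(\mathcal A)$ not containing $a_N$, the maximal simplices of $\Delta_\succ(\mathcal A)$ are the sets $G\cup\{a_N\}$ with $G$ a maximal simplex of $\Delta_\succ(\mathcal A\cap F_i)$ (recursively, with the induced order). A cone point is a vertex lying in every facet; the core is the restriction of the complex to the non-cone-point vertices. Spheres are understood up to homeomorphism of the geometric realization. *)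

theory Defs
  imports "HOL-Analysis.Analysis"
begin

text \<open>Convention: a total order on a point set is a relation R given as a set of pairs,
  where (p, q) \<in> R means p \<succ> q ("p is larger than q").\<close>

definition strict_total_order_on :: "'a set \<Rightarrow> ('a \<times> 'a) set \<Rightarrow> bool" where
  "strict_total_order_on A R \<longleftrightarrow>
     R \<subseteq> A \<times> A \<and>
     (\<forall>x\<in>A. (x, x) \<notin> R) \<and>
     (\<forall>x\<in>A. \<forall>y\<in>A. \<forall>z\<in>A. (x, y) \<in> R \<longrightarrow> (y, z) \<in> R \<longrightarrow> (x, z) \<in> R) \<and>
     (\<forall>x\<in>A. \<forall>y\<in>A. x \<noteq> y \<longrightarrow> (x, y) \<in> R \<or> (y, x) \<in> R)"

inductive revlex_max :: "('a::euclidean_space \<times> 'a) set \<Rightarrow> 'a set \<Rightarrow> 'a set \<Rightarrow> bool"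
  for R where
  single: "revlex_max R {a} {a}"
| step: "\<lbrakk> finite A; a \<in> A; \<forall>b\<in>A. b \<noteq> a \<longrightarrow> (b, a) \<in> R;
           F facet_of (convex hull A); a \<notin> F; revlex_max R (A \<inter> F) G \<rbrakk>
         \<Longrightarrow> revlex_max R A (insert a G)"

definition revlex_complex :: "('a::euclidean_space \<times> 'a) set \<Rightarrow> 'a set \<Rightarrow> 'a set set" where
  "revlex_complex R A = {\<sigma>. \<exists>G. revlex_max R A G \<and> \<sigma> \<subseteq> G}"

definition cone_points :: "('a::euclidean_space \<times> 'a) set \<Rightarrow> 'a set \<Rightarrow> 'a set" where
  "cone_points R A = {v. (\<exists>G. revlex_max R A G \<and> v \<in> G) \<and> (\<forall>G. revlex_max R A G \<longrightarrow> v \<in> G)}"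

definition revlex_core :: "('a::euclidean_space \<times> 'a) set \<Rightarrow> 'a set \<Rightarrow> 'a set set" where
  "revlex_core R A = {\<sigma> \<in> revlex_complex R A. \<sigma> \<inter> cone_points R A = {}}"

text \<open>Geometric realization of an abstract simplicial complex K with vertices of type 'v,
  as a subspace of the product space ('v \<Rightarrow> real): barycentric coordinate functions
  supported on a simplex of K.\<close>
definition geom_realization :: "'v set set \<Rightarrow> ('v \<Rightarrow> real) topology" where
  "geom_realization K = subtopology (powertop_real UNIV)
     {f. \<exists>\<sigma>\<in>K. finite \<sigma> \<and> (\<forall>v. v \<notin> \<sigma> \<longrightarrow> f v = 0) \<and> (\<forall>v\<in>\<sigma>. 0 \<le> f v) \<and> sum f \<sigma> = 1}"

text \<open>The point e_i + e_j (variable x_ij) in R^n, where the coordinates of the ambient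
  space real^'n are labelled 1..n through the bijection idx.\<close>
definition xpt :: "(nat \<Rightarrow> 'n::finite) \<Rightarrow> nat \<Rightarrow> nat \<Rightarrow> real ^ 'n" where
  "xpt idx i j = axis (idx i) 1 + axis (idx j) 1"

definition P2 :: "(nat \<Rightarrow> 'n::finite) \<Rightarrow> nat \<Rightarrow> (real ^ 'n) set" where
  "P2 idx n = {xpt idx i j | i j. 1 \<le> i \<and> i \<le> j \<and> j \<le> n}"

end

theory Submission
  imports Defs
begin

text \<open>
  Write \<open>A\<^sub>S = {e\<^sub>i + e\<^sub>j : i, j \<in> S}\<close>. Its hull is a simplex whose facets are spanned by the
  \<open>A\<^bsub>S - {i}\<^esub>\<close>, so pulling the smallest point \<open>e\<^sub>a + e\<^sub>b\<close> leaves \<open>A\<^bsub>S - {a}\<^esub>\<close> and \<open>A\<^bsub>S - {b}\<^esub>\<close>. First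
  the antidiagonal pairs are split one after the other; what remains is a set \<open>S\<close> containing exactly
  one of \<open>i\<close>, \<open>n + 1 - i\<close> for each \<open>i\<close>, and there the smallest point always joins the two extreme
  indices. Hence the cone points are the antidiagonal points, and the simplices of the core are the
  chains of nested intervals \<open>{a, b}\<close> with endpoints in such an \<open>S\<close>.

  Projecting along the antidiagonal points identifies \<open>e\<^bsub>n+1-i\<^esub>\<close> with \<open>- e\<^sub>i\<close> and turns the sets \<open>S\<close>
  into the orthants of \<open>R\<^sup>m\<close>. The core then triangulates the boundary of the cross-polytope of radius 2:
  a nonnegative weight on \<open>S\<close> is written as a combination of nested pairs by greedily matching its
  extreme indices, and the coefficients are unique because the mass of the pairs \<open>(a, b)\<close> with
  \<open>a \<le> p\<close> and \<open>q \<le> b\<close> is \<open>min 1 (min (weight up to p) (weight from q))\<close>.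
\<close>

section \<open>Measures on nested intervals\<close>

text \<open>On the support of \<open>g\<close> one condition implies the other, so the conjunction
  is the stronger of the two and carries the smaller mass.\<close>

lemma sum_of_bool_conj_comparable:
  fixes g :: "'a \<Rightarrow> real"
  assumes "finite P" and nonneg: "\<And>z. z \<in> P \<Longrightarrow> 0 \<le> g z"
    and comp: "(\<forall>z\<in>P. g z \<noteq> 0 \<longrightarrow> Q z \<longrightarrow> Q' z) \<or> (\<forall>z\<in>P. g z \<noteq> 0 \<longrightarrow> Q' z \<longrightarrow> Q z)"
  shows "(\<Sum>z\<in>P. g z * of_bool (Q z \<and> Q' z)) =
         min (\<Sum>z\<in>P. g z * of_bool (Q z)) (\<Sum>z\<in>P. g z * of_bool (Q' z))"
  using comp
proof
  assume *: "\<forall>z\<in>P. g z \<noteq> 0 \<longrightarrow> Q z \<longrightarrow> Q' z"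
  have "(\<Sum>z\<in>P. g z * of_bool (Q z \<and> Q' z)) = (\<Sum>z\<in>P. g z * of_bool (Q z))"
    by (rule sum.cong) (use * in auto)
  moreover have "(\<Sum>z\<in>P. g z * of_bool (Q z)) \<le> (\<Sum>z\<in>P. g z * of_bool (Q' z))"
    by (rule sum_mono) (use * nonneg in auto)
  ultimately show ?thesis by simp
next
  assume *: "\<forall>z\<in>P. g z \<noteq> 0 \<longrightarrow> Q' z \<longrightarrow> Q z"
  have "(\<Sum>z\<in>P. g z * of_bool (Q z \<and> Q' z)) = (\<Sum>z\<in>P. g z * of_bool (Q' z))"
    by (rule sum.cong) (use * in auto)
  moreover have "(\<Sum>z\<in>P. g z * of_bool (Q' z)) \<le> (\<Sum>z\<in>P. g z * of_bool (Q z))"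
    by (rule sum_mono) (use * nonneg in auto)
  ultimately show ?thesis by simp
qed

definition nested :: "nat \<times> nat \<Rightarrow> nat \<times> nat \<Rightarrow> bool" where
  "nested z z' \<longleftrightarrow> fst z \<le> fst z' \<and> snd z' \<le> snd z \<or> fst z' \<le> fst z \<and> snd z \<le> snd z'"

text \<open>In a chain of intervals every left end is at most every right end, also for different
  intervals. So either all left ends are at most \<open>p\<close> or no right end is, and the mass
  of the left ends up to \<open>p\<close> is the weight of all ends up to \<open>p\<close>, cut off
  at 1. The same holds from \<open>q\<close> on, and nestedness makes the two conditions
  comparable.\<close>

lemma nested_chain_sum_formula:
  fixes g :: "nat \<times> nat \<Rightarrow> real"
  assumes fin: "finite P" and le: "\<And>z. z \<in> P \<Longrightarrow> fst z \<le> snd z"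
    and nonneg: "\<And>z. z \<in> P \<Longrightarrow> 0 \<le> g z" and total: "sum g P = 1"
    and nest: "\<And>z z'. z \<in> P \<Longrightarrow> z' \<in> P \<Longrightarrow> g z \<noteq> 0 \<Longrightarrow> g z' \<noteq> 0 \<Longrightarrow> nested z z'"
  shows "(\<Sum>z\<in>P. g z * of_bool (fst z \<le> p \<and> q \<le> snd z)) =
         min 1 (min (\<Sum>z\<in>P. g z * (of_bool (fst z \<le> p) + of_bool (snd z \<le> p)))
                    (\<Sum>z\<in>P. g z * (of_bool (q \<le> fst z) + of_bool (q \<le> snd z))))"
proof -
  \<comment> \<open>\<open>Q'\<close> is the condition on the opposite end. If \<open>Q\<close>
    holds on the whole support, both sides are 1; otherwise \<open>Q'\<close> adds no mass and the
    cut-off at 1 changes nothing.\<close>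
  have half: "(\<Sum>z\<in>P. g z * of_bool (Q z)) =
      min 1 (\<Sum>z\<in>P. g z * (of_bool (Q z) + of_bool (Q' z)))"
    if cases: "(\<forall>z\<in>P. g z \<noteq> 0 \<longrightarrow> Q z) \<or> (\<forall>z\<in>P. g z \<noteq> 0 \<longrightarrow> \<not> Q' z)" for Q Q'
    using cases
  proof
    assume *: "\<forall>z\<in>P. g z \<noteq> 0 \<longrightarrow> Q z"
    have "(\<Sum>z\<in>P. g z * of_bool (Q z)) = sum g P"
      by (rule sum.cong) (use * in auto)
    moreover have "sum g P \<le> (\<Sum>z\<in>P. g z * (of_bool (Q z) + of_bool (Q' z)))"
      by (rule sum_mono) (use * nonneg in force)
    ultimately show ?thesis using total by simp
  next
    assume *: "\<forall>z\<in>P. g z \<noteq> 0 \<longrightarrow> \<not> Q' z"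
    have "(\<Sum>z\<in>P. g z * (of_bool (Q z) + of_bool (Q' z))) = (\<Sum>z\<in>P. g z * of_bool (Q z))"
      by (rule sum.cong) (use * in auto)
    moreover have "(\<Sum>z\<in>P. g z * of_bool (Q z)) \<le> sum g P"
      by (rule sum_mono) (use nonneg in auto)
    ultimately show ?thesis using total by simp
  qed
  have "(\<Sum>z\<in>P. g z * of_bool (fst z \<le> p)) =
      min 1 (\<Sum>z\<in>P. g z * (of_bool (fst z \<le> p) + of_bool (snd z \<le> p)))"
  proof (rule half, rule ccontr)
    assume "\<not> ((\<forall>z\<in>P. g z \<noteq> 0 \<longrightarrow> fst z \<le> p) \<or> (\<forall>z\<in>P. g z \<noteq> 0 \<longrightarrow> \<not> snd z \<le> p))"
    then obtain z z' where z: "z \<in> P" "g z \<noteq> 0" "\<not> fst z \<le> p" "z' \<in> P" "g z' \<noteq> 0" "snd z' \<le> p"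
      by blast
    then show False using nest[of z z'] le[of z] le[of z'] by (auto simp: nested_def)
  qed
  moreover have "(\<Sum>z\<in>P. g z * of_bool (q \<le> snd z)) =
      min 1 (\<Sum>z\<in>P. g z * (of_bool (q \<le> snd z) + of_bool (q \<le> fst z)))"
  proof (rule half, rule ccontr)
    assume "\<not> ((\<forall>z\<in>P. g z \<noteq> 0 \<longrightarrow> q \<le> snd z) \<or> (\<forall>z\<in>P. g z \<noteq> 0 \<longrightarrow> \<not> q \<le> fst z))"
    then obtain z z' where z: "z \<in> P" "g z \<noteq> 0" "\<not> q \<le> snd z" "z' \<in> P" "g z' \<noteq> 0" "q \<le> fst z'"
      by blast
    then show False using nest[of z z'] le[of z] le[of z'] by (auto simp: nested_def)
  qed
  moreover have "(\<Sum>z\<in>P. g z * of_bool (fst z \<le> p \<and> q \<le> snd z)) =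
      min (\<Sum>z\<in>P. g z * of_bool (fst z \<le> p)) (\<Sum>z\<in>P. g z * of_bool (q \<le> snd z))"
  proof (rule sum_of_bool_conj_comparable[OF fin nonneg], assumption, rule ccontr)
    assume "\<not> ((\<forall>z\<in>P. g z \<noteq> 0 \<longrightarrow> fst z \<le> p \<longrightarrow> q \<le> snd z) \<or>
      (\<forall>z\<in>P. g z \<noteq> 0 \<longrightarrow> q \<le> snd z \<longrightarrow> fst z \<le> p))"
    then obtain z z' where z: "z \<in> P" "g z \<noteq> 0" "fst z \<le> p" "\<not> q \<le> snd z"
      "z' \<in> P" "g z' \<noteq> 0" "q \<le> snd z'" "\<not> fst z' \<le> p"
      by blast
    then show False using nest[of z z'] by (auto simp: nested_def)
  qed
  ultimately show ?thesis by (simp add: add.commute min.assoc min.left_commute)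
qed

text \<open>The marginals of the endpoints determine both weights in
  \<open>nested_chain_sum_formula\<close>, hence the mass of every quadrant
  \<open>fst z <= p\<close>, \<open>q <= snd z\<close>; single masses are mixed differences of
  these.\<close>

lemma nested_chain_unique:
  fixes g g' :: "nat \<times> nat \<Rightarrow> real"
  assumes fin: "finite P" and le: "\<And>z. z \<in> P \<Longrightarrow> 1 \<le> fst z \<and> fst z \<le> snd z"
    and g: "\<And>z. z \<in> P \<Longrightarrow> 0 \<le> g z" "sum g P = 1"
       "\<And>z z'. z \<in> P \<Longrightarrow> z' \<in> P \<Longrightarrow> g z \<noteq> 0 \<Longrightarrow> g z' \<noteq> 0 \<Longrightarrow> nested z z'"
    and g': "\<And>z. z \<in> P \<Longrightarrow> 0 \<le> g' z" "sum g' P = 1"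
       "\<And>z z'. z \<in> P \<Longrightarrow> z' \<in> P \<Longrightarrow> g' z \<noteq> 0 \<Longrightarrow> g' z' \<noteq> 0 \<Longrightarrow> nested z z'"
    and marginal: "\<And>i. (\<Sum>z\<in>P. g z * (of_bool (fst z = i) + of_bool (snd z = i))) =
       (\<Sum>z\<in>P. g' z * (of_bool (fst z = i) + of_bool (snd z = i)))"
    and z: "z \<in> P"
  shows "g z = g' z"
proof -
  \<comment> \<open>A common bound on the endpoints lets the tail from \<open>q\<close> be summed as
    the finite \<open>{q..N}\<close>.\<close>
  obtain N where N: "\<And>z. z \<in> P \<Longrightarrow> fst z \<le> N \<and> snd z \<le> N"
  proof
    fix z assume "z \<in> P"
    then show "fst z \<le> Max (fst ` P \<union> snd ` P) \<and> snd z \<le> Max (fst ` P \<union> snd ` P)"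
      using fin by (auto intro!: Max_ge)
  qed
  have marginal_sum: "(\<Sum>z\<in>P. h z * (of_bool (fst z \<in> I) + of_bool (snd z \<in> I))) =
      (\<Sum>i\<in>I. \<Sum>z\<in>P. h z * (of_bool (fst z = i) + of_bool (snd z = i)))"
    if "finite I" for I and h :: "nat \<times> nat \<Rightarrow> real"
  proof -
    have one: "(\<Sum>i\<in>I. of_bool (k = i)) = (of_bool (k \<in> I) :: real)" for k
      using that by (simp add: of_bool_def)
    show ?thesis
      by (subst sum.swap) (simp add: sum.distrib one flip: sum_distrib_left)
  qed
  have "(\<Sum>z\<in>P. g z * (of_bool (fst z \<in> I) + of_bool (snd z \<in> I))) =
      (\<Sum>z\<in>P. g' z * (of_bool (fst z \<in> I) + of_bool (snd z \<in> I)))" if "finite I" for I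
    by (simp add: marginal_sum that marginal)
  from this[of "{..p}" for p] this[of "{q..N}" for q]
  have low: "(\<Sum>z\<in>P. g z * (of_bool (fst z \<le> p) + of_bool (snd z \<le> p))) =
      (\<Sum>z\<in>P. g' z * (of_bool (fst z \<le> p) + of_bool (snd z \<le> p)))" 
    and high: "(\<Sum>z\<in>P. g z * (of_bool (q \<le> fst z) + of_bool (q \<le> snd z))) =
      (\<Sum>z\<in>P. g' z * (of_bool (q \<le> fst z) + of_bool (q \<le> snd z)))" for p q
    using N by (auto cong: sum.cong)
  define F where "F h p q = (\<Sum>z\<in>P. h z * of_bool (fst z \<le> p \<and> q \<le> snd z))"
    for h :: "nat \<times> nat \<Rightarrow> real" and p q
  have F_eq: "F g p q = F g' p q" for p q
    unfolding F_def
    by (subst (1 2) nested_chain_sum_formula) (use fin le g g' low high in auto)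
  \<comment> \<open>Inclusion-exclusion over four quadrants isolates the point \<open>z\<close>.
    Since \<open>1 <= fst z\<close>, the truncated \<open>fst z - 1\<close> is a true
    predecessor.\<close>
  have recover: "h z = F h (fst z) (snd z) - F h (fst z - 1) (snd z) - F h (fst z) (snd z + 1)
      + F h (fst z - 1) (snd z + 1)" for h :: "nat \<times> nat \<Rightarrow> real"
  proof -
    have "h z = (\<Sum>y\<in>P. h y * of_bool (y = z))"
      using fin z by (simp add: of_bool_def if_distrib[of "\<lambda>t. _ * t"] cong: if_cong)
    also have "\<dots> = (\<Sum>y\<in>P. h y * of_bool (fst y \<le> fst z \<and> snd z \<le> snd y)
        - h y * of_bool (fst y \<le> fst z - 1 \<and> snd z \<le> snd y)
        - h y * of_bool (fst y \<le> fst z \<and> snd z + 1 \<le> snd y)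
        + h y * of_bool (fst y \<le> fst z - 1 \<and> snd z + 1 \<le> snd y))"
    proof (rule sum.cong[OF refl])
      fix y
      have "fst y \<le> fst z - 1 \<longleftrightarrow> fst y < fst z" "snd z + 1 \<le> snd y \<longleftrightarrow> snd z < snd y"
        using le[OF z] by auto
      moreover have "y = z \<longleftrightarrow> fst y = fst z \<and> snd y = snd z" by (simp add: prod_eq_iff)
      ultimately show "h y * of_bool (y = z) = h y * of_bool (fst y \<le> fst z \<and> snd z \<le> snd y)
        - h y * of_bool (fst y \<le> fst z - 1 \<and> snd z \<le> snd y)
        - h y * of_bool (fst y \<le> fst z \<and> snd z + 1 \<le> snd y)
        + h y * of_bool (fst y \<le> fst z - 1 \<and> snd z + 1 \<le> snd y)"
        by (cases "fst y" "fst z" rule: linorder_cases; cases "snd y" "snd z" rule: linorder_cases) simp_all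
    qed
    finally show ?thesis
      by (simp add: F_def sum.distrib sum_subtractf)
  qed
  show ?thesis
    by (subst (1 2) recover) (simp add: F_eq)
qed

section \<open>Compactness of finite realizations\<close>

text \<open>Each closed simplex is a closed subset of the cube of functions with values in
  \<open>{0..1}\<close>, which is compact by Tychonoff's theorem; finitely many of them have a
  compact union.\<close>

lemma compact_space_geom_realization:
  assumes "finite K"
  shows "compact_space (geom_realization K)"
proof -
  let ?X = "powertop_real (UNIV :: 'a set)"
  define B where "B \<sigma> = {f :: 'a \<Rightarrow> real. finite \<sigma> \<and> (\<forall>v. v \<notin> \<sigma> \<longrightarrow> f v = 0) \<and>
      (\<forall>v\<in>\<sigma>. 0 \<le> f v) \<and> sum f \<sigma> = 1}" for \<sigma> :: "'a set"
  have "compactin ?X (B \<sigma>)" for \<sigma>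
  proof (cases "finite \<sigma>")
    case fin: True
    define C where "C v = {f :: 'a \<Rightarrow> real. if v \<in> \<sigma> then 0 \<le> f v else f v = 0}" for v
    have proj: "closedin ?X {f \<in> topspace ?X. f v \<in> T}" if "closed T" for v and T :: "real set"
      by (rule closedin_continuous_map_preimage[of _ euclideanreal])
         (use that continuous_map_product_projection[of v UNIV "\<lambda>_. euclideanreal"] in auto)
    have "closedin ?X (C v)" for v
      using proj[of "{0..}" v] proj[of "{0}" v] by (cases "v \<in> \<sigma>") (auto simp: C_def)
    then have "closedin ?X (\<Inter>v. C v)" by (intro closedin_Inter) auto
    moreover have "closedin ?X {f \<in> topspace ?X. sum f \<sigma> \<in> {1}}"
      by (rule closedin_continuous_map_preimage[of _ euclideanreal])
         (use fin in \<open>auto intro!: continuous_map_sum continuous_map_product_projection\<close>)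
    ultimately have "closedin ?X ((\<Inter>v. C v) \<inter> {f \<in> topspace ?X. sum f \<sigma> \<in> {1}})"
      by (rule closedin_Int)
    also have "(\<Inter>v. C v) \<inter> {f \<in> topspace ?X. sum f \<sigma> \<in> {1}} = B \<sigma>"
      using fin by (auto simp: C_def B_def split: if_splits)
    finally have closed: "closedin ?X (B \<sigma>)" .
    have "f v \<le> 1" if "f \<in> B \<sigma>" for f v
    proof (cases "v \<in> \<sigma>")
      case True
      then have "f v \<le> sum f \<sigma>" using that fin by (intro member_le_sum) (auto simp: B_def)
      then show ?thesis using that by (simp add: B_def)
    qed (use that in \<open>auto simp: B_def\<close>)
    moreover have "0 \<le> f v" if "f \<in> B \<sigma>" for f v
      using that by (cases "v \<in> \<sigma>") (auto simp: B_def)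
    ultimately have "B \<sigma> \<subseteq> PiE UNIV (\<lambda>_. {0..1})" by auto
    moreover have "compactin ?X (PiE UNIV (\<lambda>_. {0..1}))"
      by (simp add: compactin_PiE)
    ultimately show ?thesis using closed closed_compactin by blast
  qed (simp add: B_def)
  then have "compactin ?X (\<Union>\<sigma>\<in>K. B \<sigma>)"
    using assms by (intro compactin_Union) auto
  moreover have "geom_realization K = subtopology ?X (\<Union>\<sigma>\<in>K. B \<sigma>)"
    unfolding geom_realization_def B_def by (rule arg_cong[where f = "subtopology _"]) auto
  ultimately show ?thesis by (simp add: compact_space_subtopology)
qed

section \<open>Facets of the dilated simplex\<close>

lemma revlex_max_subset: "revlex_max R A G \<Longrightarrow> G \<subseteq> A"
  by (induction rule: revlex_max.induct) auto

locale veronese =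
  fixes n :: nat and idx :: "nat \<Rightarrow> 'n::finite"
  assumes idx: "bij_betw idx {1..n} (UNIV :: 'n set)"
begin

text \<open>The indices are unordered, which avoids sorting when a pair is built from two elements
  of \<open>S\<close>; sorted representatives come from \<open>pts_ordered\<close>.\<close>

definition pts :: "nat set \<Rightarrow> (real ^ 'n) set" where
  "pts S = {xpt idx i j | i j. i \<in> S \<and> j \<in> S}"

lemma xpt_commute: "xpt idx i j = xpt idx j i"
  by (simp add: xpt_def add.commute)

lemma xpt_nth:
  assumes "i \<in> {1..n}" "j \<in> {1..n}" "k \<in> {1..n}"
  shows "xpt idx i j $ idx k = of_bool (i = k) + of_bool (j = k)"
proof -
  have "idx i = idx k \<longleftrightarrow> i = k" "idx j = idx k \<longleftrightarrow> j = k"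
    using bij_betw_imp_inj_on[OF idx] assms by (metis inj_on_eq_iff)+
  then show ?thesis by (auto simp: xpt_def axis_def)
qed

text \<open>Coordinate \<open>idx k\<close> of a point counts how often \<open>k\<close> occurs in
  its pair, so the point determines the pair as a multiset.\<close>

lemma xpt_eq_iff:
  assumes "i \<in> {1..n}" "j \<in> {1..n}" "h \<in> {1..n}" "k \<in> {1..n}" "i \<le> j" "h \<le> k"
  shows "xpt idx i j = xpt idx h k \<longleftrightarrow> i = h \<and> j = k"
proof
  assume "xpt idx i j = xpt idx h k"
  then have "of_bool (i = l) + of_bool (j = l) = (of_bool (h = l) + of_bool (k = l) :: real)"
    if "l \<in> {1..n}" for l
    using assms that by (metis xpt_nth)
  from this[of i] this[of j] this[of h] this[of k] show "i = h \<and> j = k"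
    using assms by (auto split: if_splits simp: of_bool_def)
qed simp

lemma finite_pts: "finite S \<Longrightarrow> finite (pts S)"
  unfolding pts_def by (rule finite_subset[of _ "(\<lambda>(i, j). xpt idx i j) ` (S \<times> S)"]) auto

lemma pts_ordered: "v \<in> pts S \<Longrightarrow> \<exists>i j. i \<in> S \<and> j \<in> S \<and> i \<le> j \<and> v = xpt idx i j"
  unfolding pts_def by (auto, metis nat_le_linear xpt_commute)

lemma P2_eq_pts: "P2 idx n = pts {1..n}"
proof
  show "P2 idx n \<subseteq> pts {1..n}" by (force simp: P2_def pts_def)
  show "pts {1..n} \<subseteq> P2 idx n" 
    using pts_ordered by (force simp: P2_def)
qed

text \<open>\<open>xpt idx i j\<close> is the midpoint of the vertices \<open>xpt idx i i\<close>
  and \<open>xpt idx j j\<close>.\<close>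

lemma hull_pts: "convex hull (pts S) = convex hull ((\<lambda>i. xpt idx i i) ` S)"
proof (rule antisym; rule hull_minimal)
  have "xpt idx i j \<in> convex hull ((\<lambda>i. xpt idx i i) ` S)" if "i \<in> S" "j \<in> S" for i j
  proof -
    have "(1/2) *\<^sub>R xpt idx i i + (1/2) *\<^sub>R xpt idx j j \<in> convex hull ((\<lambda>i. xpt idx i i) ` S)"
      by (rule convexD) (use that in \<open>auto intro: hull_inc\<close>)
    moreover have "(1/2) *\<^sub>R xpt idx i i + (1/2) *\<^sub>R xpt idx j j = xpt idx i j"
      by (simp add: xpt_def vec_eq_iff field_simps)
    ultimately show ?thesis by simp
  qed
  then show "pts S \<subseteq> convex hull ((\<lambda>i. xpt idx i i) ` S)"
    by (auto simp: pts_def)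
  show "(\<lambda>i. xpt idx i i) ` S \<subseteq> convex hull (pts S)"
    by (auto simp: pts_def intro!: hull_inc)
qed (auto simp: convex_convex_hull)

lemma inj_on_double: "S \<subseteq> {1..n} \<Longrightarrow> inj_on (\<lambda>i. xpt idx i i) S"
  by (rule inj_onI) (use xpt_eq_iff in blast)

text \<open>The vertices \<open>xpt idx i i\<close> are nonzero and pairwise orthogonal, so the hull
  is a simplex and a facet omits one vertex. The bound on \<open>card S\<close> is there because
  facets are nonempty: a single point has none.\<close>

lemma facet_of_hull_pts:
  assumes S: "S \<subseteq> {1..n}"
  shows "F facet_of (convex hull (pts S)) \<longleftrightarrow>
    2 \<le> card S \<and> (\<exists>i\<in>S. F = convex hull (pts (S - {i})))"
proof -
  let ?d = "\<lambda>i. xpt idx i i"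
  have "independent (?d ` S)"
  proof (rule pairwise_orthogonal_independent)
    show "pairwise orthogonal (?d ` S)"
    proof (clarsimp simp: pairwise_def)
      fix i j assume "i \<in> S" "j \<in> S" "?d i \<noteq> ?d j"
      then have "idx i \<noteq> idx j"
        by (auto simp: xpt_def)
      then show "orthogonal (?d i) (?d j)"
        unfolding xpt_def orthogonal_def inner_add_left inner_add_right inner_axis_axis by simp
    qed
    show "0 \<notin> ?d ` S"
    proof
      assume "0 \<in> ?d ` S"
      then obtain i where "i \<in> S" "?d i = 0" by auto
      then show False using xpt_nth[of i i i] S by auto
    qed
  qed
  then have "\<not> affine_dependent (?d ` S)"
    using affine_dependent_imp_dependent by blast
  moreover have "card (?d ` S) = card S"
    by (rule card_image) (rule inj_on_double[OF S])
  moreover have "?d ` S - {?d i} = ?d ` (S - {i})" if "i \<in> S" for i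
    using inj_on_image_set_diff[OF inj_on_double[OF S], of S "{i}"] that by auto
  ultimately show ?thesis
    by (auto simp: facet_of_convex_hull_affine_independent_alt hull_pts)
qed

text \<open>For \<open>k\<close> outside \<open>S\<close> the hull lies in the hyperplane where
  coordinate \<open>idx k\<close> vanishes, whereas a point has positive coordinates at its own
  indices.\<close>

lemma xpt_in_hull_pts:
  assumes S: "S \<subseteq> {1..n}" and ij: "i \<in> {1..n}" "j \<in> {1..n}"
  shows "xpt idx i j \<in> convex hull (pts S) \<longleftrightarrow> i \<in> S \<and> j \<in> S"
proof
  assume L: "xpt idx i j \<in> convex hull (pts S)"
  have "k \<in> S" if k: "k \<in> {1..n}" "xpt idx i j $ idx k > 0" for k
  proof (rule ccontr)
    assume "k \<notin> S"
    have "convex {v::real^'n. v $ idx k = 0}"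
      by (auto simp: convex_def)
    moreover have "pts S \<subseteq> {v. v $ idx k = 0}"
    proof
      fix v assume "v \<in> pts S"
      then obtain h l where hl: "h \<in> S" "l \<in> S" "v = xpt idx h l" by (auto simp: pts_def)
      then have "h \<in> {1..n}" "l \<in> {1..n}" "h \<noteq> k" "l \<noteq> k" using S \<open>k \<notin> S\<close> by auto
      then show "v \<in> {v. v $ idx k = 0}" using k(1) hl by (simp add: xpt_nth)
    qed
    ultimately have "convex hull pts S \<subseteq> {v. v $ idx k = 0}"
      by (rule hull_minimal[rotated])
    then show False using L k by auto
  qed
  from this[of i] this[of j] show "i \<in> S \<and> j \<in> S"
    using ij by (auto simp: xpt_nth)
qed (auto simp: pts_def intro!: hull_inc)

lemma pts_Int_facet:
  assumes S: "S \<subseteq> {1..n}"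
  shows "pts S \<inter> convex hull (pts (S - {i})) = pts (S - {i})"
proof -
  have "xpt idx h k \<in> convex hull (pts (S - {i})) \<longleftrightarrow> h \<in> S - {i} \<and> k \<in> S - {i}"
    if "h \<in> S" "k \<in> S" for h k
    by (rule xpt_in_hull_pts) (use that S in auto)
  then show ?thesis by (auto simp: pts_def) blast+
qed

text \<open>A single point has no facets, which leaves only the base rule.\<close>

lemma revlex_max_pts_singleton:
  assumes "i \<in> {1..n}"
  shows "revlex_max R (pts {i}) G \<longleftrightarrow> G = {xpt idx i i}"
proof -
  have eq: "pts {i} = {xpt idx i i}" by (auto simp: pts_def)
  have "\<not> F facet_of (convex hull (pts {i}))" for F
    using assms by (simp add: facet_of_hull_pts)
  then have nofacet: "\<not> F facet_of (convex hull {xpt idx i i})" for F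
    by (simp add: eq)
  show ?thesis
    unfolding eq by (auto intro: revlex_max.single elim: revlex_max.cases simp: nofacet)
qed

text \<open>A facet avoids the smallest point \<open>xpt idx a b\<close> exactly when it omits the
  vertex of \<open>a\<close> or of \<open>b\<close>, which gives two branches. The hypothesis
  \<open>asym\<close> makes the smallest point unique, so inverting the rule \<open>step\<close>
  returns this very point.\<close>

lemma revlex_max_pts_step:
  assumes S: "S \<subseteq> {1..n}" and ab: "a \<in> S" "b \<in> S" "a < b"
    and least: "\<And>v. v \<in> pts S \<Longrightarrow> v \<noteq> xpt idx a b \<Longrightarrow> (v, xpt idx a b) \<in> R"
    and asym: "\<And>v. v \<in> pts S \<Longrightarrow> v \<noteq> xpt idx a b \<Longrightarrow> (xpt idx a b, v) \<notin> R"
  shows "revlex_max R (pts S) G \<longleftrightarrow>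
    (\<exists>G'. (revlex_max R (pts (S - {a})) G' \<or> revlex_max R (pts (S - {b})) G')
          \<and> G = insert (xpt idx a b) G')"
proof -
  have fin: "finite S" using S finite_subset by blast
  have "{a, b} \<subseteq> S" using ab by auto
  then have card: "2 \<le> card S"
    using ab fin card_mono[of S "{a, b}"] by simp
  have ab_pts: "xpt idx a b \<in> pts S" using ab by (auto simp: pts_def)
  have a: "xpt idx a b \<in> convex hull pts (S - {i}) \<longleftrightarrow> a \<noteq> i \<and> b \<noteq> i" for i
    by (subst xpt_in_hull_pts) (use S ab in auto)
  show ?thesis
  proof
    assume "revlex_max R (pts S) G"
    then show "\<exists>G'. (revlex_max R (pts (S - {a})) G' \<or> revlex_max R (pts (S - {b})) G')
          \<and> G = insert (xpt idx a b) G'"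
    proof cases
      \<comment> \<open>Impossible, since \<open>a < b\<close> gives \<open>pts S\<close> two
        distinct points.\<close>
      case (single c)
      then have "xpt idx a a = xpt idx a b" using ab by (force simp: pts_def)
      then show ?thesis using xpt_eq_iff[of a a a b] ab S[THEN subsetD] by auto
    next
      case (step c F G')
      have "c = xpt idx a b" using step(3,4) ab_pts asym by metis
      moreover obtain i where "i \<in> S" "F = convex hull pts (S - {i})"
        using step(5) facet_of_hull_pts[OF S] by auto
      ultimately show ?thesis
        using step a[of i] pts_Int_facet[OF S, of i] by auto
    qed
  next
    assume "\<exists>G'. (revlex_max R (pts (S - {a})) G' \<or> revlex_max R (pts (S - {b})) G')
          \<and> G = insert (xpt idx a b) G'"
    then obtain G' i where i: "i = a \<or> i = b" and G': "revlex_max R (pts (S - {i})) G'"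
      and G: "G = insert (xpt idx a b) G'" by auto
    show "revlex_max R (pts S) G"
      unfolding G
    proof (rule revlex_max.step)
      show "convex hull pts (S - {i}) facet_of convex hull pts S"
        using facet_of_hull_pts[OF S] card i ab by auto
      show "xpt idx a b \<notin> convex hull pts (S - {i})" using a i by auto
      show "revlex_max R (pts S \<inter> convex hull pts (S - {i})) G'"
        using G' by (simp add: pts_Int_facet[OF S])
    qed (use finite_pts[OF fin] ab_pts least in auto)
  qed
qed

end

section \<open>The simplices of the triangulation\<close>

locale antidiagonal_revlex = veronese n idx for n and idx :: "nat \<Rightarrow> 'n::finite" +
  fixes m :: nat and R :: "((real ^ 'n) \<times> (real ^ 'n)) set"
  assumes m: "m \<ge> 1" and n: "n = 2 * m"
    and tot: "strict_total_order_on (P2 idx n) R"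
    and anti_chain: "\<And>i i'. 1 \<le> i \<Longrightarrow> i < i' \<Longrightarrow> i' \<le> m \<Longrightarrow>
           (xpt idx i' (n + 1 - i'), xpt idx i (n + 1 - i)) \<in> R"
    and anti_small: "\<And>i j h. 1 \<le> i \<Longrightarrow> i \<le> j \<Longrightarrow> j \<le> n \<Longrightarrow> i + j \<noteq> n + 1 \<Longrightarrow>
           1 \<le> h \<Longrightarrow> h \<le> m \<Longrightarrow> (xpt idx i j, xpt idx h (n + 1 - h)) \<in> R"
    and others: "\<And>i j h k. 1 \<le> i \<Longrightarrow> i \<le> j \<Longrightarrow> j \<le> n \<Longrightarrow> i + j \<noteq> n + 1 \<Longrightarrow>
           1 \<le> h \<Longrightarrow> h \<le> k \<Longrightarrow> k \<le> n \<Longrightarrow> h + k \<noteq> n + 1 \<Longrightarrow>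
           j - i < k - h \<Longrightarrow> (xpt idx i j, xpt idx h k) \<in> R"
begin

text \<open>Letting \<open>i\<close> run over all of \<open>{1..n}\<close> lists each antidiagonal
  point twice, once from either of its indices, so neither index has to be singled out.\<close>

definition antidiag :: "(real ^ 'n) set" where
  "antidiag = (\<lambda>i. xpt idx i (n + 1 - i)) ` {1..n}"

section \<open>The smallest point of an index set\<close>

lemma order_asym: "(u, v) \<in> R \<Longrightarrow> (v, u) \<notin> R"
  using tot unfolding strict_total_order_on_def by blast

lemma xpt_in_antidiag_iff:
  assumes "i \<in> {1..n}" "j \<in> {1..n}"
  shows "xpt idx i j \<in> antidiag \<longleftrightarrow> i + j = n + 1"
proof
  assume "i + j = n + 1"
  then have "j = n + 1 - i" by simp
  then show "xpt idx i j \<in> antidiag" using assms by (auto simp: antidiag_def)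
next
  assume "xpt idx i j \<in> antidiag"
  then obtain k where k: "k \<in> {1..n}" "xpt idx i j = xpt idx k (n + 1 - k)"
    by (auto simp: antidiag_def)
  have "xpt idx (min i j) (max i j) = xpt idx (min k (n + 1 - k)) (max k (n + 1 - k))"
    using k(2) by (metis max_def min_def xpt_commute)
  then have "min i j = min k (n + 1 - k) \<and> max i j = max k (n + 1 - k)"
    by (subst (asm) xpt_eq_iff) (use assms k(1) in auto)
  then have "min i j + max i j = min k (n + 1 - k) + max k (n + 1 - k)"
    by simp
  then show "i + j = n + 1" using k(1) by (simp add: min_add_distrib_left max_def min_def split: if_splits)
qed

text \<open>Antidiagonal points lie below all others, and among them the outermost is smallest, so
  the least index \<open>a\<close> of an antidiagonal pair inside \<open>S\<close> gives the
  smallest point.\<close>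

lemma least_point_pair:
  assumes S: "S \<subseteq> {1..n}" and pair: "k \<in> S" "n + 1 - k \<in> S"
  obtains a b where "a \<in> S" "b \<in> S" "a < b" "a + b = n + 1"
    "\<And>v. v \<in> pts S \<Longrightarrow> v \<noteq> xpt idx a b \<Longrightarrow> (v, xpt idx a b) \<in> R"
proof -
  define a where "a = (LEAST a. a \<in> S \<and> n + 1 - a \<in> S)"
  have a: "a \<in> S" "n + 1 - a \<in> S"
    using LeastI[of "\<lambda>a. a \<in> S \<and> n + 1 - a \<in> S" k] pair by (auto simp: a_def)
  have least: "a \<le> c" if "c \<in> S" "n + 1 - c \<in> S" for c
    unfolding a_def using that by (simp add: Least_le)
  have a1: "1 \<le> a" "a \<le> n" using a S by auto
  \<comment> \<open>The partner of \<open>a\<close> satisfies the same condition, so minimality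
    applies to it; equality fails because \<open>n + 1\<close> is odd.\<close>
  have "a \<le> n + 1 - a" by (rule least) (use a a1 in auto)
  then have am: "a \<le> m" "a < n + 1 - a" using n a1 by presburger+
  show ?thesis
  proof (rule that[of a "n + 1 - a"])
    fix v assume v: "v \<in> pts S" "v \<noteq> xpt idx a (n + 1 - a)"
    obtain c d where cd: "c \<in> S" "d \<in> S" "c \<le> d" "v = xpt idx c d"
      using pts_ordered[OF v(1)] by blast
    then have cd': "1 \<le> c" "d \<le> n" using S by auto
    show "(v, xpt idx a (n + 1 - a)) \<in> R"
    proof (cases "c + d = n + 1")
      case True
      then have d: "d = n + 1 - c" by simp
      have "a \<le> c" by (rule least) (use cd d in auto)
      moreover have "a \<noteq> c" using v cd d by auto
      moreover have "c \<le> m" using True cd n by auto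
      ultimately show ?thesis using anti_chain[of a c] a1 d cd by auto
    next
      case False
      then show ?thesis using anti_small[of c d a] cd cd' a1 am by auto
    qed
  qed (use a am in auto)
qed

text \<open>Without antidiagonal pairs every point of \<open>pts S\<close> falls under
  \<open>others\<close>, and the extreme pair has strictly the largest index difference.\<close>

lemma least_point_ends:
  assumes S: "S \<subseteq> {1..n}" and nopair: "\<And>i. i \<in> S \<Longrightarrow> n + 1 - i \<notin> S"
    and ab: "a \<in> S" "b \<in> S" "S \<subseteq> {a..b}"
    and v: "v \<in> pts S" "v \<noteq> xpt idx a b"
  shows "(v, xpt idx a b) \<in> R"
proof -
  obtain c d where cd: "c \<in> S" "d \<in> S" "c \<le> d" "v = xpt idx c d"
    using pts_ordered[OF v(1)] by blast
  have no: "i + j \<noteq> n + 1" if "i \<in> S" "j \<in> S" for i j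
    using nopair[of i] that by (metis add_diff_cancel_left')
  have "a \<le> c" "d \<le> b" using cd ab by auto
  moreover have "c \<noteq> a \<or> d \<noteq> b" using v cd by auto
  ultimately have "d - c < b - a" using cd(3) by linarith
  then show ?thesis
    unfolding cd(4)
    by (intro others) (use S ab cd no[of a b] no[of c d] in auto)
qed

section \<open>Structure of the maximal simplices\<close>

text \<open>An induction that follows the pulling recursion: as long as an antidiagonal pair is
  present, one is pulled (\<open>pair\<close>), afterwards the two extreme indices are
  (\<open>ends\<close>). Both cases hand over the recursion for \<open>revlex_max\<close>, so facets
  and the order do not reappear.\<close>

lemma revlex_induct [consumes 2, case_names single pair ends]:
  assumes S: "S \<subseteq> {1..n}" "S \<noteq> {}"
    and single: "\<And>i. i \<in> {1..n} \<Longrightarrow> Pr {i}"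
    and pair: "\<And>S a b. S \<subseteq> {1..n} \<Longrightarrow> a \<in> S \<Longrightarrow> b \<in> S \<Longrightarrow> a < b \<Longrightarrow> a + b = n + 1 \<Longrightarrow>
      (\<And>G. revlex_max R (pts S) G \<longleftrightarrow>
        (\<exists>G'. (revlex_max R (pts (S - {a})) G' \<or> revlex_max R (pts (S - {b})) G')
              \<and> G = insert (xpt idx a b) G')) \<Longrightarrow>
      Pr (S - {a}) \<Longrightarrow> Pr (S - {b}) \<Longrightarrow> Pr S"
    and ends: "\<And>S a b. S \<subseteq> {1..n} \<Longrightarrow> a \<in> S \<Longrightarrow> b \<in> S \<Longrightarrow> a < b \<Longrightarrow>
      (\<And>i. i \<in> S \<Longrightarrow> n + 1 - i \<notin> S) \<Longrightarrow> S \<subseteq> {a..b} \<Longrightarrow>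
      (\<And>G. revlex_max R (pts S) G \<longleftrightarrow>
        (\<exists>G'. (revlex_max R (pts (S - {a})) G' \<or> revlex_max R (pts (S - {b})) G')
              \<and> G = insert (xpt idx a b) G')) \<Longrightarrow>
      Pr (S - {a}) \<Longrightarrow> Pr (S - {b}) \<Longrightarrow> Pr S"
  shows "Pr S"
  using S
proof (induction "card S" arbitrary: S rule: less_induct)
  case less
  have fin: "finite S" using less.prems(1) finite_subset by blast
  \<comment> \<open>The index \<open>b\<close> only witnesses that \<open>S - {a}\<close> is
    nonempty.\<close>
  have IH: "Pr (S - {a})" if "a \<in> S" "b \<in> S" "a \<noteq> b" for a b
  proof (rule less.hyps)
    show "card (S - {a}) < card S" using fin that by (meson card_Diff1_less)
  qed (use less.prems that in auto)
  show ?case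
  proof (cases "\<exists>k\<in>S. n + 1 - k \<in> S")
    case True
    then obtain a b where ab: "a \<in> S" "b \<in> S" "a < b" "a + b = n + 1"
      and "\<And>v. v \<in> pts S \<Longrightarrow> v \<noteq> xpt idx a b \<Longrightarrow> (v, xpt idx a b) \<in> R"
      using least_point_pair[OF less.prems(1)] by metis
    then show ?thesis
      by (intro pair[OF less.prems(1) ab revlex_max_pts_step[OF less.prems(1)]] IH[of a b] IH[of b a])
         (auto dest: order_asym)
  next
    case False
    define a b where "a = Min S" and "b = Max S"
    have ab: "a \<in> S" "b \<in> S" "S \<subseteq> {a..b}"
      using fin less.prems(2) by (auto simp: a_def b_def)
    show ?thesis
    proof (cases "a = b")
      case True
      then have "S = {a}" using ab by auto
      then show ?thesis using single[of a] less.prems(1) by auto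
    next
      case neq: False
      then have "a < b" using ab by fastforce
      have least: "(v, xpt idx a b) \<in> R" if "v \<in> pts S" "v \<noteq> xpt idx a b" for v
        by (rule least_point_ends[OF less.prems(1) _ ab that]) (use False in auto)
      show ?thesis
        by (intro ends[OF less.prems(1) ab(1,2) \<open>a < b\<close> _ ab(3)
              revlex_max_pts_step[OF less.prems(1) ab(1,2) \<open>a < b\<close>]] IH[of a b] IH[of b a])
           (use False least ab neq in \<open>auto dest: order_asym\<close>)
    qed
  qed
qed

text \<open>While both \<open>i\<close> and its partner are present, only \<open>pair\<close> steps
  occur, and those of other pairs delete neither. So one of the two can disappear only in the step
  that pulls their own point; a singleton is excluded by parity.\<close>

lemma antidiag_in_revlex_max:
  assumes "S \<subseteq> {1..n}" "S \<noteq> {}"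
  shows "revlex_max R (pts S) G \<Longrightarrow> i \<in> S \<Longrightarrow> n + 1 - i \<in> S \<Longrightarrow> xpt idx i (n + 1 - i) \<in> G"
  using assms
proof (induction S arbitrary: G i rule: revlex_induct)
  case (single k)
  then show ?case using n by auto presburger
next
  case (pair S a b)
  obtain G' where G': "revlex_max R (pts (S - {a})) G' \<or> revlex_max R (pts (S - {b})) G'"
    and G: "G = insert (xpt idx a b) G'"
    using pair.prems(1) pair.hyps(6) by blast
  show ?case
  proof (cases "i = a \<or> i = b")
    case True
    then have "xpt idx i (n + 1 - i) = xpt idx a b"
      using \<open>a + b = n + 1\<close> by (metis add_diff_cancel_left' add_diff_cancel_right' xpt_commute)
    then show ?thesis using G by simp
  next
    case False
    moreover have "n + 1 - i \<noteq> a" "n + 1 - i \<noteq> b"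
      using False \<open>a + b = n + 1\<close> pair.prems(2) pair.hyps(1) by auto
    ultimately show ?thesis using G G' pair.IH pair.prems by blast
  qed
next
  case (ends S a b)
  then show ?case by blast
qed

text \<open>\<open>T\<close> is the index set left once all antidiagonal pairs are split, and
  \<open>C\<close> lists the pairs pulled from then on; each of them encloses all later ones. Points
  pulled before are antidiagonal and drop out of the conclusion.\<close>

lemma revlex_max_nested_chain:
  assumes "S \<subseteq> {1..n}" "S \<noteq> {}"
  shows "revlex_max R (pts S) G \<Longrightarrow>
    \<exists>T C. T \<subseteq> S \<and> (\<forall>i\<in>T. n + 1 - i \<notin> T) \<and> C \<subseteq> {(a, b). a \<in> T \<and> b \<in> T \<and> a \<le> b}
       \<and> (\<forall>z\<in>C. \<forall>z'\<in>C. nested z z') \<and> G - antidiag \<subseteq> (\<lambda>(a, b). xpt idx a b) ` C"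
  using assms
proof (induction S arbitrary: G rule: revlex_induct)
  case (single i)
  then have "G = {xpt idx i i}" by (simp add: revlex_max_pts_singleton)
  moreover have "n + 1 - i \<noteq> i" using n by presburger
  ultimately show ?case
    by (intro exI[of _ "{i}"] exI[of _ "{(i, i)}"]) (auto simp: nested_def)
next
  case (pair S a b)
  obtain G' where G': "revlex_max R (pts (S - {a})) G' \<or> revlex_max R (pts (S - {b})) G'"
    and G: "G = insert (xpt idx a b) G'"
    using pair.prems(1) pair.hyps(6) by blast
  have "xpt idx a b \<in> antidiag"
    using pair.hyps(1-3,5) xpt_in_antidiag_iff[of a b] by auto
  then have "G - antidiag = G' - antidiag" using G by auto
  moreover obtain c where "revlex_max R (pts (S - {c})) G'" "c = a \<or> c = b"
    using G' by blast
  then obtain T C where "T \<subseteq> S - {c}" "\<forall>i\<in>T. n + 1 - i \<notin> T"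
    "C \<subseteq> {(a, b). a \<in> T \<and> b \<in> T \<and> a \<le> b}" "\<forall>z\<in>C. \<forall>z'\<in>C. nested z z'"
    "G' - antidiag \<subseteq> (\<lambda>(a, b). xpt idx a b) ` C"
    using pair.IH[of G'] by (elim disjE) auto
  ultimately show ?case by (intro exI[of _ T] exI[of _ C]) auto
next
  case (ends S a b)
  obtain G' where G': "revlex_max R (pts (S - {a})) G' \<or> revlex_max R (pts (S - {b})) G'"
    and G: "G = insert (xpt idx a b) G'"
    using ends.prems(1) ends.hyps(7) by blast
  obtain c where "revlex_max R (pts (S - {c})) G'" "c = a \<or> c = b"
    using G' by blast
  then obtain T C where T: "T \<subseteq> S - {c}" and C: "C \<subseteq> {(a, b). a \<in> T \<and> b \<in> T \<and> a \<le> b}"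
    "\<forall>z\<in>C. \<forall>z'\<in>C. nested z z'" "G' - antidiag \<subseteq> (\<lambda>(a, b). xpt idx a b) ` C"
    using ends.IH[of G'] by (elim disjE) auto
  have "nested (a, b) z \<and> nested z (a, b)" if "z \<in> C" for z
    using that C(1) T ends.hyps(6) by (fastforce simp: nested_def)
  then have "\<forall>z\<in>insert (a, b) C. \<forall>z'\<in>insert (a, b) C. nested z z'"
    using C(2) by (auto simp: nested_def)
  \<comment> \<open>The induction hypothesis gave only a set \<open>T\<close> lacking one end. The
    new one is all of \<open>S\<close>, which contains \<open>a\<close> and \<open>b\<close> and no
    antidiagonal pair.\<close>
  then show ?case
    using ends.hyps(2-5) C(1,3) G T
    by (intro exI[of _ S] exI[of _ "insert (a, b) C"] conjI) auto
qed

section \<open>Index weights and greedy matching\<close>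

definition coord :: "(real ^ 'n \<Rightarrow> real) \<Rightarrow> nat \<Rightarrow> real" where
  "coord f k = (\<Sum>v\<in>pts {1..n}. f v * v $ idx k)"

lemma coord_add_point:
  assumes "u \<in> pts {1..n}"
  shows "coord (\<lambda>v. f v + (if v = u then t else 0)) k = coord f k + t * u $ idx k"
proof -
  have "coord (\<lambda>v. f v + (if v = u then t else 0)) k =
      coord f k + (\<Sum>v\<in>pts {1..n}. if v = u then t * u $ idx k else 0)"
    unfolding coord_def sum.distrib[symmetric] by (rule sum.cong) (auto simp: algebra_simps)
  then show ?thesis using assms by (simp add: finite_pts)
qed

text \<open>At a \<open>pair\<close> step one of the two indices has weight 0 and is deleted; the
  pulled point gets no mass. At an \<open>ends\<close> step the smaller end weight is subtracted
  from both ends and becomes the coefficient of the pulled point; an index left with weight 0 is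
  deleted.\<close>

lemma revlex_max_covers:
  assumes "S \<subseteq> {1..n}" "S \<noteq> {}"
  shows "(\<And>i. 0 \<le> w i) \<Longrightarrow> (\<And>i. i \<in> {1..n} \<Longrightarrow> w i = 0 \<or> w (n + 1 - i) = 0) \<Longrightarrow>
    (\<And>i. i \<notin> S \<Longrightarrow> w i = 0) \<Longrightarrow>
    \<exists>G f. revlex_max R (pts S) G \<and> (\<forall>v. 0 \<le> f v) \<and> (\<forall>v. v \<notin> G - antidiag \<longrightarrow> f v = 0) \<and>
      (\<forall>k\<in>{1..n}. coord f k = w k)"
  using assms
proof (induction S arbitrary: w rule: revlex_induct)
  case (single i)
  \<comment> \<open>The weight is halved because coordinate \<open>idx i\<close> of
    \<open>xpt idx i i\<close> is 2; the summand 0 gives the shape required by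
    \<open>coord_add_point\<close>.\<close>
  define f where "f = (\<lambda>v. 0 + (if v = xpt idx i i then w i / 2 else 0))"
  have i: "xpt idx i i \<in> pts {1..n}" using single.hyps by (auto simp: pts_def)
  have "xpt idx i i \<notin> antidiag"
    using single.hyps xpt_in_antidiag_iff[of i i] n by auto presburger
  moreover have "coord f k = w k" if "k \<in> {1..n}" for k
    unfolding f_def coord_add_point[OF i] using that single.hyps single.prems(3)[of k]
    by (auto simp: coord_def xpt_nth)
  ultimately show ?case
    using single.prems(1) single.hyps
    by (intro exI[of _ "{xpt idx i i}"] exI[of _ f]) (auto simp: f_def revlex_max_pts_singleton)
next
  case (pair S a b)
  have "\<exists>c\<in>{a, b}. w c = 0"
  proof -
    have "b = n + 1 - a" using pair.hyps(5) by simp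
    then show ?thesis using pair.prems(2)[of a] pair.hyps(1,2) by auto
  qed
  then obtain c where c: "c \<in> {a, b}" "w c = 0" by blast
  have "\<exists>G f. revlex_max R (pts (S - {c})) G \<and> (\<forall>v. 0 \<le> f v) \<and>
      (\<forall>v. v \<notin> G - antidiag \<longrightarrow> f v = 0) \<and> (\<forall>k\<in>{1..n}. coord f k = w k)"
  proof -
    have "w i = 0" if "i \<notin> S - {c}" for i
      using that pair.prems(3)[of i] c(2) by auto
    then show ?thesis using c(1) pair.IH[of w] pair.prems(1,2) by blast
  qed
  then obtain G f where G: "revlex_max R (pts (S - {c})) G" "\<forall>v. 0 \<le> f v"
      "\<forall>v. v \<notin> G - antidiag \<longrightarrow> f v = 0" "\<forall>k\<in>{1..n}. coord f k = w k"
    by blast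
  then show ?case
    using pair.hyps(6)[of "insert (xpt idx a b) G"] c(1)
    by (intro exI[of _ "insert (xpt idx a b) G"] exI[of _ f]) auto
next
  case (ends S a b)
  define t where "t = min (w a) (w b)"
  define w' where "w' = (\<lambda>k. if k = a \<or> k = b then w k - t else w k)"
  have "\<exists>c\<in>{a, b}. w' c = 0" by (auto simp: w'_def t_def)
  then obtain c where c: "c \<in> {a, b}" "w' c = 0" by blast
  have t0: "0 \<le> t" using ends.prems(1) by (simp add: t_def)
  \<comment> \<open>As \<open>w'\<close> lies between 0 and \<open>w\<close>, it inherits every zero
    of \<open>w\<close> and so both vanishing hypotheses.\<close>
  have w'0: "0 \<le> w' k" and w'w: "w' k \<le> w k" for k
    using ends.prems(1) t0 by (auto simp: w'_def t_def)
  have w': "w' i = 0 \<or> w' (n + 1 - i) = 0" if "i \<in> {1..n}" for i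
    using ends.prems(2)[OF that] w'0 w'w by (metis order_antisym)
  have w'S: "w' i = 0" if "i \<notin> S - {c}" for i
    using that c(2) ends.prems(3)[of i] w'0[of i] w'w[of i] by (cases "i = c") auto
  have "\<exists>G f. revlex_max R (pts (S - {c})) G \<and> (\<forall>v. 0 \<le> f v) \<and>
      (\<forall>v. v \<notin> G - antidiag \<longrightarrow> f v = 0) \<and> (\<forall>k\<in>{1..n}. coord f k = w' k)"
    using c(1) ends.IH[of w'] w'0 w' w'S by blast
  then obtain G f where G: "revlex_max R (pts (S - {c})) G" "\<forall>v. 0 \<le> f v"
      "\<forall>v. v \<notin> G - antidiag \<longrightarrow> f v = 0" "\<forall>k\<in>{1..n}. coord f k = w' k"
    by blast
  define f' where "f' = (\<lambda>v. f v + (if v = xpt idx a b then t else 0))"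
  have ab: "a \<in> {1..n}" "b \<in> {1..n}" using ends.hyps(1-3) by auto
  then have "xpt idx a b \<in> pts {1..n}" by (auto simp: pts_def)
  then have "coord f' k = w k" if "k \<in> {1..n}" for k
    unfolding f'_def using coord_add_point[of "xpt idx a b" f t k] that ab G(4) ends.hyps(4)
    by (auto simp: xpt_nth w'_def)
  moreover have "a + b \<noteq> n + 1"
    using ends.hyps(5)[of a] ends.hyps(2,3) by (metis add_diff_cancel_left')
  then have "xpt idx a b \<notin> antidiag"
    using xpt_in_antidiag_iff ab by blast
  ultimately show ?case
    using ends.hyps(7)[of "insert (xpt idx a b) G"] c(1) G t0
    by (intro exI[of _ "insert (xpt idx a b) G"] exI[of _ f']) (auto simp: f'_def)
qed

section \<open>Core functions as measures on index pairs\<close>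

lemma n_ge_2: "2 \<le> n"
  using m n by simp

lemma pairs_bij: "bij_betw (\<lambda>(a, b). xpt idx a b) {(a, b). 1 \<le> a \<and> a \<le> b \<and> b \<le> n} (pts {1..n})"
  unfolding bij_betw_def
proof
  show "inj_on (\<lambda>(a, b). xpt idx a b) {(a, b). 1 \<le> a \<and> a \<le> b \<and> b \<le> n}"
    by (rule inj_onI) (clarsimp simp: xpt_eq_iff)
  show "(\<lambda>(a, b). xpt idx a b) ` {(a, b). 1 \<le> a \<and> a \<le> b \<and> b \<le> n} = pts {1..n}"
  proof
    show "(\<lambda>(a, b). xpt idx a b) ` {(a, b). 1 \<le> a \<and> a \<le> b \<and> b \<le> n} \<subseteq> pts {1..n}"
      by (force simp: pts_def)
    show "pts {1..n} \<subseteq> (\<lambda>(a, b). xpt idx a b) ` {(a, b). 1 \<le> a \<and> a \<le> b \<and> b \<le> n}"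
      using pts_ordered[of _ "{1..n}"] by force
  qed
qed

lemma sum_pts_eq:
  "sum h (pts {1..n}) = (\<Sum>z\<in>{(a, b). 1 \<le> a \<and> a \<le> b \<and> b \<le> n}. h (xpt idx (fst z) (snd z)))"
  using sum.reindex_bij_betw[OF pairs_bij, of h] by (simp add: case_prod_unfold)

text \<open>Exhibits \<open>coord f\<close> as the endpoint marginal of
  \<open>nested_chain_unique\<close>; a pair with equal ends counts twice, just as
  \<open>xpt idx k k\<close> has coordinate 2.\<close>

lemma coord_eq_pair_sum:
  assumes "k \<in> {1..n}"
  shows "coord f k = (\<Sum>z\<in>{(a, b). 1 \<le> a \<and> a \<le> b \<and> b \<le> n}.
    f (xpt idx (fst z) (snd z)) * (of_bool (fst z = k) + of_bool (snd z = k)))"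
  unfolding coord_def sum_pts_eq
  by (rule sum.cong) (use assms in \<open>auto simp: xpt_nth\<close>)

lemma finite_pairs: "finite {(a, b). 1 \<le> a \<and> a \<le> b \<and> b \<le> (n::nat)}"
  by (rule finite_subset[of _ "{..n} \<times> {..n}"]) auto

text \<open>Every point has coordinate sum 2, so total mass 1 means total weight 2; this is the
  radius of the cross-polytope.\<close>

lemma sum_coord: "(\<Sum>k=1..n. coord f k) = 2 * sum f (pts {1..n})"
proof -
  have "(\<Sum>k=1..n. v $ idx k) = 2" if v: "v \<in> pts {1..n}" for v
  proof -
    obtain i j where "i \<in> {1..n}" "j \<in> {1..n}" "v = xpt idx i j"
      using pts_ordered[OF v] by blast
    then have "(\<Sum>k=1..n. v $ idx k) = (\<Sum>k=1..n. of_bool (i = k) + of_bool (j = k))"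
      by (intro sum.cong) (auto simp: xpt_nth)
    also have "\<dots> = 2"
      using \<open>i \<in> {1..n}\<close> \<open>j \<in> {1..n}\<close> by (simp add: sum.distrib of_bool_def)
    finally show ?thesis .
  qed
  then show ?thesis
    unfolding coord_def
    by (subst sum.swap) (simp flip: sum_distrib_left sum_distrib_right add: mult.commute)
qed

text \<open>The barycentric coordinate functions of the core, once its cone points are known to be the
  antidiagonal points.\<close>

definition core_functions :: "(real ^ 'n \<Rightarrow> real) set" where
  "core_functions = {f. (\<exists>G. revlex_max R (pts {1..n}) G \<and> (\<forall>v. v \<notin> G - antidiag \<longrightarrow> f v = 0))
     \<and> (\<forall>v. 0 \<le> f v) \<and> sum f (pts {1..n}) = 1}"

text \<open>Transfers the chain from points to index pairs: sorted indices are determined by their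
  point, so they are the very pair listed in \<open>C\<close>.\<close>

lemma support_chain:
  assumes "revlex_max R (pts {1..n}) G"
  obtains T C where "T \<subseteq> {1..n}" "\<And>i. i \<in> T \<Longrightarrow> n + 1 - i \<notin> T"
    "\<And>a b. (a, b) \<in> C \<Longrightarrow> a \<in> T \<and> b \<in> T \<and> a \<le> b"
    "\<And>z z'. z \<in> C \<Longrightarrow> z' \<in> C \<Longrightarrow> nested z z'"
    "\<And>a b. 1 \<le> a \<Longrightarrow> a \<le> b \<Longrightarrow> b \<le> n \<Longrightarrow> xpt idx a b \<in> G - antidiag \<Longrightarrow> (a, b) \<in> C"
proof -
  have "{1..n} \<noteq> {}" using n_ge_2 by auto
  from revlex_max_nested_chain[of "{1..n}", OF subset_refl this assms]
  obtain T C where TC: "T \<subseteq> {1..n}" "\<forall>i\<in>T. n + 1 - i \<notin> T"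
    "C \<subseteq> {(a, b). a \<in> T \<and> b \<in> T \<and> a \<le> b}" "\<forall>z\<in>C. \<forall>z'\<in>C. nested z z'"
    "G - antidiag \<subseteq> (\<lambda>(a, b). xpt idx a b) ` C"
    by (elim exE conjE)
  show ?thesis
  proof (rule that[OF TC(1), of C])
    fix a b assume ab: "1 \<le> a" "a \<le> b" "b \<le> n" "xpt idx a b \<in> G - antidiag"
    then obtain c d where cd: "(c, d) \<in> C" "xpt idx a b = xpt idx c d" using TC(5) by auto
    then have "c \<in> {1..n}" "d \<in> {1..n}" "c \<le> d" using TC(1,3) by auto
    then have "a = c \<and> b = d" using xpt_eq_iff[of a b c d] ab cd by auto
    then show "(a, b) \<in> C" using cd by simp
  qed (use TC in auto)
qed

lemma coord_nonzero_in_support: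
  assumes G: "revlex_max R (pts {1..n}) G" and f: "\<And>v. v \<notin> G - antidiag \<Longrightarrow> f v = 0"
    and k: "k \<in> {1..n}" "coord f k \<noteq> 0"
  obtains a b where "1 \<le> a" "a \<le> b" "b \<le> n" "xpt idx a b \<in> G - antidiag" "k = a \<or> k = b"
proof -
  obtain v where v: "v \<in> pts {1..n}" "f v * v $ idx k \<noteq> 0"
    using k(2) unfolding coord_def by (meson sum.not_neutral_contains_not_neutral)
  obtain a b where ab: "a \<in> {1..n}" "b \<in> {1..n}" "a \<le> b" "v = xpt idx a b"
    using pts_ordered[OF v(1)] by blast
  moreover have "v \<in> G - antidiag" using v f[of v] by auto
  moreover have "k = a \<or> k = b" using v(2) ab xpt_nth[of a b k] k(1) by auto
  ultimately show ?thesis using that[of a b] by auto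
qed

text \<open>Indices of nonzero weight occur in the support of \<open>f\<close>, hence lie in the set
  \<open>T\<close> of \<open>support_chain\<close>, which contains no antidiagonal pair.\<close>

lemma coord_antipodal:
  assumes f: "f \<in> core_functions" and i: "i \<in> {1..n}"
  shows "coord f i = 0 \<or> coord f (n + 1 - i) = 0"
proof (rule ccontr)
  assume neg: "\<not> ?thesis"
  obtain G where G: "revlex_max R (pts {1..n}) G" "\<And>v. v \<notin> G - antidiag \<Longrightarrow> f v = 0"
    using f unfolding core_functions_def by blast
  obtain T C where T: "\<And>i. i \<in> T \<Longrightarrow> n + 1 - i \<notin> T"
    and C: "\<And>a b. (a, b) \<in> C \<Longrightarrow> a \<in> T \<and> b \<in> T \<and> a \<le> b"
    "\<And>a b. 1 \<le> a \<Longrightarrow> a \<le> b \<Longrightarrow> b \<le> n \<Longrightarrow> xpt idx a b \<in> G - antidiag \<Longrightarrow> (a, b) \<in> C"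
    using support_chain[OF G(1)] by metis
  have "k \<in> T" if "k \<in> {1..n}" "coord f k \<noteq> 0" for k
    using coord_nonzero_in_support[OF G that] C by metis
  moreover have "n + 1 - i \<in> {1..n}" using i by auto
  ultimately show False using i neg T by blast
qed

text \<open>Read on index pairs, a core function is a probability measure supported on a chain, and
  \<open>coord\<close> gives its marginals, so \<open>nested_chain_unique\<close> applies.\<close>

lemma core_functions_eqI:
  assumes f: "f \<in> core_functions" and f': "f' \<in> core_functions"
    and eq: "\<And>k. k \<in> {1..n} \<Longrightarrow> coord f k = coord f' k"
  shows "f = f'"
proof
  fix v
  let ?P = "{(a, b). 1 \<le> a \<and> a \<le> b \<and> b \<le> n}"
  define g where "g h z = h (xpt idx (fst z) (snd z))" for h :: "real ^ 'n \<Rightarrow> real" and z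
  \<comment> \<open>A core function lives on the whole space; its vanishing off
    \<open>pts {1..n}\<close> comes from its support in a maximal simplex.\<close>
  have outside: "h v = 0" if h: "h \<in> core_functions" and v: "v \<notin> pts {1..n}" for h
  proof -
    obtain G where "revlex_max R (pts {1..n}) G" "\<And>v. v \<notin> G - antidiag \<Longrightarrow> h v = 0"
      using h unfolding core_functions_def by blast
    then show ?thesis using v revlex_max_subset by blast
  qed
  have chain: "nested z z'"
    if h: "h \<in> core_functions" and z: "z \<in> ?P" "z' \<in> ?P" "g h z \<noteq> 0" "g h z' \<noteq> 0" for h z z'
  proof -
    obtain G where G: "revlex_max R (pts {1..n}) G" "\<And>v. v \<notin> G - antidiag \<Longrightarrow> h v = 0"
      using h unfolding core_functions_def by blast
    obtain C where C: "\<And>z z'. z \<in> C \<Longrightarrow> z' \<in> C \<Longrightarrow> nested z z'"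
      "\<And>a b. 1 \<le> a \<Longrightarrow> a \<le> b \<Longrightarrow> b \<le> n \<Longrightarrow> xpt idx a b \<in> G - antidiag \<Longrightarrow> (a, b) \<in> C"
      using support_chain[OF G(1)] by metis
    have "y \<in> C" if "y \<in> ?P" "g h y \<noteq> 0" for y
      using that C(2)[of "fst y" "snd y"] G(2)[of "xpt idx (fst y) (snd y)"]
      by (auto simp: g_def case_prod_unfold)
    then show ?thesis using C(1) z by blast
  qed
  have total: "sum (g h) ?P = 1" if "h \<in> core_functions" for h
    using that sum_pts_eq[of h] by (simp add: core_functions_def g_def)
  have marginal: "(\<Sum>z\<in>?P. g f z * (of_bool (fst z = i) + of_bool (snd z = i))) =
       (\<Sum>z\<in>?P. g f' z * (of_bool (fst z = i) + of_bool (snd z = i)))" for i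
  proof (cases "i \<in> {1..n}")
    case True
    then show ?thesis using eq[OF True] by (simp add: coord_eq_pair_sum g_def)
  next
    case False
    then show ?thesis by (intro sum.cong) auto
  qed
  have "g f z = g f' z" if "z \<in> ?P" for z
    by (rule nested_chain_unique[OF finite_pairs _ _ total[OF f] chain[OF f]
          _ total[OF f'] chain[OF f'] marginal that])
       (use f f' in \<open>auto simp: core_functions_def g_def\<close>)
  then have "f (xpt idx a b) = f' (xpt idx a b)" if "1 \<le> a" "a \<le> b" "b \<le> n" for a b
    using that by (force simp: g_def)
  then show "f v = f' v"
    using outside[OF f] outside[OF f'] pts_ordered[of v "{1..n}"] by fastforce
qed

lemma core_function_exists:
  assumes "\<And>i. 0 \<le> w i" "\<And>i. i \<in> {1..n} \<Longrightarrow> w i = 0 \<or> w (n + 1 - i) = 0"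
    and "\<And>i. i \<notin> {1..n} \<Longrightarrow> w i = 0" and total: "(\<Sum>i=1..n. w i) = 2"
  obtains f where "f \<in> core_functions" "\<And>k. k \<in> {1..n} \<Longrightarrow> coord f k = w k"
proof -
  have "{1..n} \<noteq> {}" using n_ge_2 by auto
  from revlex_max_covers[of "{1..n}" w, OF subset_refl this assms(1-3)]
  obtain G f where G: "revlex_max R (pts {1..n}) G" "\<forall>v. 0 \<le> f v"
    "\<forall>v. v \<notin> G - antidiag \<longrightarrow> f v = 0" "\<forall>k\<in>{1..n}. coord f k = w k"
    by blast
  have "2 * sum f (pts {1..n}) = 2"
    using sum_coord[of f] total G(4) by simp
  then have "f \<in> core_functions" using G by (auto simp: core_functions_def)
  then show ?thesis using that G(4) by blast
qed

section \<open>Cone points and the realization of the core\<close>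

text \<open>Weight 2 at the single index \<open>k\<close> is a vertex of the cross-polytope. This
  yields maximal simplices that use a prescribed index off the antidiagonal.\<close>

lemma core_function_at_vertex:
  assumes "k \<in> {1..n}"
  obtains f where "f \<in> core_functions" "coord f k = 2"
proof -
  let ?w = "\<lambda>i. if i = k then 2 else 0 :: real"
  have nonneg: "0 \<le> ?w i" for i by simp
  have outside: "?w i = 0" if "i \<notin> {1..n}" for i using that assms by auto
  have "(\<Sum>i=1..n. ?w i) = 2" using assms by simp
  moreover have "?w i = 0 \<or> ?w (n + 1 - i) = 0" for i
    using n by auto presburger
  ultimately obtain f where "f \<in> core_functions" "\<And>i. i \<in> {1..n} \<Longrightarrow> coord f i = ?w i"
    using core_function_exists[of ?w, OF nonneg _ outside] by metis
  then show ?thesis using that assms by auto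
qed

text \<open>No point \<open>xpt idx i j\<close> off the antidiagonal lies in all maximal simplices:
  one carrying weight at the partner \<open>n + 1 - i\<close> has that partner in its set
  \<open>T\<close>, which then excludes \<open>i\<close>.\<close>

lemma cone_points_eq: "cone_points R (P2 idx n) = antidiag"
proof
  \<comment> \<open>\<open>cone_points\<close> demands that some maximal simplex contain the point,
    so one has to exist; any core function supplies it.\<close>
  obtain f where "f \<in> core_functions"
    using core_function_at_vertex[of 1] n_ge_2 by auto
  then obtain G0 where G0: "revlex_max R (pts {1..n}) G0"
    unfolding core_functions_def by blast
  have "xpt idx i (n + 1 - i) \<in> G" if "i \<in> {1..n}" "revlex_max R (pts {1..n}) G" for i G
  proof -
    have "n + 1 - i \<in> {1..n}" using that(1) by auto
    then show ?thesis using antidiag_in_revlex_max[of "{1..n}" G i] that by blast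
  qed
  then show "antidiag \<subseteq> cone_points R (P2 idx n)"
    using G0 unfolding cone_points_def P2_eq_pts antidiag_def by blast
  show "cone_points R (P2 idx n) \<subseteq> antidiag"
  proof (rule subsetI, rule ccontr)
    fix v assume v: "v \<in> cone_points R (P2 idx n)" "v \<notin> antidiag"
    then have vG: "\<And>G. revlex_max R (pts {1..n}) G \<Longrightarrow> v \<in> G"
      by (auto simp: cone_points_def P2_eq_pts)
    then have "v \<in> pts {1..n}" using G0 revlex_max_subset by blast
    then obtain i j where ij: "i \<in> {1..n}" "j \<in> {1..n}" "i \<le> j" "v = xpt idx i j"
      using pts_ordered by blast
    then have ni: "n + 1 - i \<in> {1..n}" by auto
    then obtain f where f: "f \<in> core_functions" "coord f (n + 1 - i) = 2"
      using core_function_at_vertex by blast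
    obtain G where G: "revlex_max R (pts {1..n}) G" "\<And>v. v \<notin> G - antidiag \<Longrightarrow> f v = 0"
      using f unfolding core_functions_def by blast
    obtain T C where T: "\<And>i. i \<in> T \<Longrightarrow> n + 1 - i \<notin> T"
      and C: "\<And>a b. (a, b) \<in> C \<Longrightarrow> a \<in> T \<and> b \<in> T \<and> a \<le> b"
      "\<And>a b. 1 \<le> a \<Longrightarrow> a \<le> b \<Longrightarrow> b \<le> n \<Longrightarrow> xpt idx a b \<in> G - antidiag \<Longrightarrow> (a, b) \<in> C"
      using support_chain[OF G(1)] by metis
    have "coord f (n + 1 - i) \<noteq> 0" using f by simp
    from coord_nonzero_in_support[OF G ni this] obtain a b
      where "1 \<le> a" "a \<le> b" "b \<le> n" "xpt idx a b \<in> G - antidiag" "n + 1 - i = a \<or> n + 1 - i = b" .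
    then have "n + 1 - i \<in> T" using C(1)[OF C(2)[of a b]] by metis
    moreover have "i \<in> T"
      using C(1)[OF C(2)[of i j]] ij vG[OF G(1)] v(2) by auto
    ultimately show False using T by blast
  qed
qed

text \<open>Zero values are allowed on a face, so a function on any core face inside
  \<open>G\<close> is also one on the largest such face, \<open>G - antidiag\<close>.\<close>

lemma topspace_core:
  "topspace (geom_realization (revlex_core R (P2 idx n))) = core_functions"
proof -
  have "(\<exists>\<sigma>\<in>revlex_core R (P2 idx n). finite \<sigma> \<and> (\<forall>v. v \<notin> \<sigma> \<longrightarrow> f v = 0) \<and>
      (\<forall>v\<in>\<sigma>. 0 \<le> f v) \<and> sum f \<sigma> = 1) \<longleftrightarrow> f \<in> core_functions" (is "?L \<longleftrightarrow> ?R") for f :: "real ^ 'n \<Rightarrow> real"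
  proof
    assume ?L
    then obtain \<sigma> G where \<sigma>: "revlex_max R (pts {1..n}) G" "\<sigma> \<subseteq> G" "\<sigma> \<inter> antidiag = {}"
      "\<forall>v. v \<notin> \<sigma> \<longrightarrow> f v = 0" "\<forall>v\<in>\<sigma>. 0 \<le> f v" "sum f \<sigma> = 1"
      unfolding revlex_core_def cone_points_eq unfolding revlex_complex_def P2_eq_pts by auto
    have "sum f \<sigma> = sum f (pts {1..n})"
      by (rule sum.mono_neutral_left) (use \<sigma> revlex_max_subset[OF \<sigma>(1)] in \<open>auto simp: finite_pts\<close>)
    moreover have "0 \<le> f v" for v using \<sigma>(4,5) by (cases "v \<in> \<sigma>") auto
    moreover have "\<forall>v. v \<notin> G - antidiag \<longrightarrow> f v = 0" using \<sigma>(2-4) by blast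
    ultimately show ?R using \<sigma>(1,6) unfolding core_functions_def by auto
  next
    assume ?R
    then obtain G where G: "revlex_max R (pts {1..n}) G" "\<forall>v. v \<notin> G - antidiag \<longrightarrow> f v = 0"
      "\<forall>v. 0 \<le> f v" "sum f (pts {1..n}) = 1"
      by (auto simp: core_functions_def)
    have sub: "G - antidiag \<subseteq> pts {1..n}" using revlex_max_subset[OF G(1)] by blast
    have "sum f (G - antidiag) = sum f (pts {1..n})"
      by (rule sum.mono_neutral_left) (use G sub in \<open>auto simp: finite_pts\<close>)
    moreover have "finite (G - antidiag)"
      using sub by (rule finite_subset) (simp add: finite_pts)
    moreover have "G - antidiag \<in> revlex_core R (P2 idx n)"
      using G(1) unfolding revlex_core_def cone_points_eq unfolding revlex_complex_def P2_eq_pts by blast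
    ultimately show ?L using G by (intro bexI[of _ "G - antidiag"]) auto
  qed
  then show ?thesis by (simp add: geom_realization_def)
qed

section \<open>The core as the boundary of a cross-polytope\<close>

text \<open>Projection along the span of the antidiagonal points; it maps the realization of the core onto
  the boundary of a cross-polytope.\<close>

definition proj :: "(real ^ 'n \<Rightarrow> real) \<Rightarrow> nat \<Rightarrow> real" where
  "proj f k = (if k < m then coord f (k + 1) - coord f (n - k) else 0)"

lemma coord_nonneg:
  assumes "f \<in> core_functions" "k \<in> {1..n}"
  shows "0 \<le> coord f k"
  unfolding coord_eq_pair_sum[OF assms(2)]
  using assms(1) by (auto simp: core_functions_def intro!: sum_nonneg mult_nonneg_nonneg)

text \<open>Coordinate \<open>k\<close> of \<open>proj\<close> compares the index
  \<open>k + 1\<close> with its partner \<open>n - k\<close>. Their weights are nonnegative and one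
  of them is 0, hence they are the positive and the negative part of the difference.\<close>

lemma coord_from_proj:
  assumes f: "f \<in> core_functions" and k: "k < m"
  shows "coord f (k + 1) = max 0 (proj f k)" "coord f (n - k) = max 0 (- proj f k)"
proof -
  have "n + 1 - (k + 1) = n - k" by simp
  then have "coord f (k + 1) = 0 \<or> coord f (n - k) = 0"
    using coord_antipodal[OF f, of "k + 1"] k n by auto
  moreover have "0 \<le> coord f (k + 1)" "0 \<le> coord f (n - k)"
    by (rule coord_nonneg[OF f], use k n in simp)+
  ultimately show "coord f (k + 1) = max 0 (proj f k)" "coord f (n - k) = max 0 (- proj f k)"
    using k by (auto simp: proj_def)
qed

lemma sum_fold_pairs: "(\<Sum>i=1..n. h i) = (\<Sum>k<m. h (k + 1) + h (n - k))" for h :: "nat \<Rightarrow> real"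
proof -
  have "{1..n} = {1..m} \<union> {m+1..n}" "{1..m} \<inter> {m+1..n} = {}" using n by auto
  then have "(\<Sum>i=1..n. h i) = (\<Sum>i=1..m. h i) + (\<Sum>i=m+1..n. h i)"
    by (metis finite_atLeastAtMost sum.union_disjoint)
  moreover have "(\<Sum>i=1..m. h i) = (\<Sum>k<m. h (k + 1))"
    by (rule sum.reindex_bij_witness[of _ "\<lambda>k. k + 1" "\<lambda>i. i - 1"]) auto
  moreover have "(\<Sum>i=m+1..n. h i) = (\<Sum>k<m. h (n - k))"
    by (rule sum.reindex_bij_witness[of _ "\<lambda>k. n - k" "\<lambda>i. n - i"]) (use n in auto)
  ultimately show ?thesis by (simp add: sum.distrib)
qed

text \<open>The absolute value adds the positive and the negative part, and all index weights add up
  to 2.\<close>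

lemma proj_l1_norm:
  assumes "f \<in> core_functions"
  shows "(\<Sum>k<m. \<bar>proj f k\<bar>) = 2"
proof -
  have "(\<Sum>k<m. \<bar>proj f k\<bar>) = (\<Sum>k<m. coord f (k + 1) + coord f (n - k))"
  proof (rule sum.cong[OF refl])
    fix k assume "k \<in> {..<m}"
    then have "k < m" by simp
    from coord_from_proj[OF assms this]
    show "\<bar>proj f k\<bar> = coord f (k + 1) + coord f (n - k)" by linarith
  qed
  also have "\<dots> = 2"
    using sum_coord[of f] assms unfolding sum_fold_pairs by (simp add: core_functions_def)
  finally show ?thesis .
qed

lemma proj_inj:
  assumes f: "f \<in> core_functions" "f' \<in> core_functions" and eq: "\<And>k. k < m \<Longrightarrow> proj f k = proj f' k"
  shows "f = f'"
proof (rule core_functions_eqI[OF f])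
  fix i assume i: "i \<in> {1..n}"
  show "coord f i = coord f' i"
  proof (cases "i \<le> m")
    case True
    then have "i = (i - 1) + 1" "i - 1 < m" using i by auto
    then show ?thesis using coord_from_proj(1)[OF f(1)] coord_from_proj(1)[OF f(2)] eq by metis
  next
    case False
    then have "i = n - (n - i)" "n - i < m" using i n by auto
    then show ?thesis using coord_from_proj(2)[OF f(1)] coord_from_proj(2)[OF f(2)] eq by metis
  qed
qed

lemma proj_surj:
  assumes "(\<Sum>k<m. \<bar>y k\<bar>) = 2"
  obtains f where "f \<in> core_functions" "\<And>k. k < m \<Longrightarrow> proj f k = y k"
proof -
  \<comment> \<open>Inverse to \<open>coord_from_proj\<close>: the positive part of
    \<open>y k\<close> goes to index \<open>k + 1\<close>, the negative part to its partner
    \<open>n - k\<close>.\<close>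
  define w where "w i = (if i \<in> {1..m} then max 0 (y (i - 1))
    else if i \<in> {m+1..n} then max 0 (- y (n - i)) else 0)" for i
  have w: "w (k + 1) = max 0 (y k)" "w (n - k) = max 0 (- y k)" if "k < m" for k
    using that n by (auto simp: w_def)
  have "(\<Sum>i=1..n. w i) = (\<Sum>k<m. \<bar>y k\<bar>)"
    unfolding sum_fold_pairs by (rule sum.cong) (use w in auto)
  then have "(\<Sum>i=1..n. w i) = 2" using assms by simp
  moreover have "w i = 0 \<or> w (n + 1 - i) = 0" if "i \<in> {1..n}" for i
  proof (cases "i \<le> m")
    case True
    then show ?thesis using w[of "i - 1"] that by (auto simp: Suc_diff_le)
  next
    case False
    then have "n - i < m" "n + 1 - i = (n - i) + 1" "n - (n - i) = i" using that n by auto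
    then show ?thesis using w[of "n - i"] by auto
  qed
  moreover have "0 \<le> w i" for i by (simp add: w_def)
  moreover have "w i = 0" if "i \<notin> {1..n}" for i using that n by (auto simp: w_def)
  ultimately obtain f where f: "f \<in> core_functions" "\<And>k. k \<in> {1..n} \<Longrightarrow> coord f k = w k"
    using core_function_exists[of w] by metis
  have "proj f k = y k" if "k < m" for k
  proof -
    have "k + 1 \<in> {1..n}" "n - k \<in> {1..n}" using that n by auto
    then have "coord f (k + 1) = max 0 (y k)" "coord f (n - k) = max 0 (- y k)"
      using f(2) w[OF that] by auto
    then show ?thesis using that by (simp add: proj_def)
  qed
  then show ?thesis using that f(1) by blast
qed

definition proj_norm :: "(real ^ 'n \<Rightarrow> real) \<Rightarrow> real" where
  "proj_norm f = sqrt (\<Sum>k<m. (proj f k)\<^sup>2)"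

lemma proj_norm_pos:
  assumes "f \<in> core_functions"
  shows "0 < proj_norm f"
proof -
  have "\<exists>k<m. proj f k \<noteq> 0"
    using proj_l1_norm[OF assms] by (metis (mono_tags, lifting) abs_zero lessThan_iff sum.neutral zero_neq_numeral)
  then have "0 < (\<Sum>k<m. (proj f k)\<^sup>2)"
    by (auto intro!: sum_pos2)
  then show ?thesis by (simp add: proj_norm_def)
qed

text \<open>\<open>proj\<close> is a bijection onto the l1-sphere of radius 2, and dividing by
  \<open>proj_norm\<close> maps this sphere radially onto the Euclidean one. A continuous bijection
  from a compact space to a Hausdorff space is a homeomorphism.\<close>

theorem core_homeomorphic_sphere:
  "geom_realization (revlex_core R (P2 idx n)) homeomorphic_space nsphere (m - 1)"
proof -
  let ?X = "geom_realization (revlex_core R (P2 idx n))"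
  let ?h = "\<lambda>f k. proj f k / proj_norm f"
  have atMost: "{..m - 1} = {..<m}" using m by auto
  \<comment> \<open>\<open>nsphere\<close> consists of functions on all of \<open>nat\<close> that
    vanish beyond \<open>m - 1\<close>; the value 0 of \<open>proj\<close> from \<open>m\<close> on
    matches this.\<close>
  have topS: "topspace (nsphere (m - 1)) = {y. (\<Sum>k<m. (y k)\<^sup>2) = 1 \<and> (\<forall>k\<ge>m. y k = 0)}"
    unfolding nsphere atMost using m by (simp add: Suc_le_eq[symmetric])
  have sphere: "?h f \<in> topspace (nsphere (m - 1))" if "f \<in> core_functions" for f
    using proj_norm_pos[OF that] unfolding topS
    by (auto simp: power_divide proj_norm_def proj_def[of f] sum_nonneg simp flip: sum_divide_distrib)
  have coord_cont: "continuous_map ?X euclideanreal (\<lambda>f. coord f k)" for k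
    unfolding geom_realization_def coord_def
    by (intro continuous_map_from_subtopology continuous_map_sum continuous_map_real_mult_right
          continuous_map_product_projection) (auto simp: finite_pts)
  have proj_cont: "continuous_map ?X euclideanreal (\<lambda>f. proj f k)" for k
    by (cases "k < m") (auto simp: proj_def intro!: continuous_map_diff coord_cont)
  have "continuous_map ?X euclideanreal proj_norm"
    unfolding proj_norm_def
    by (intro continuous_map_sqrt continuous_map_sum continuous_map_real_pow proj_cont) auto
  then have "continuous_map ?X euclideanreal (\<lambda>f. ?h f k)" for k
    by (intro continuous_map_real_divide proj_cont) (auto simp: topspace_core dest: proj_norm_pos)
  then have "continuous_map ?X (powertop_real UNIV) ?h"
    by (simp add: continuous_map_componentwise_UNIV)
  moreover have "?h \<in> topspace ?X \<rightarrow> topspace (nsphere (m - 1))"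
    using sphere by (auto simp: topspace_core)
  ultimately have cont: "continuous_map ?X (nsphere (m - 1)) ?h"
    unfolding nsphere by (simp add: continuous_map_in_subtopology)
  have "revlex_core R (P2 idx n) \<subseteq> Pow (pts {1..n})"
    unfolding revlex_core_def revlex_complex_def P2_eq_pts using revlex_max_subset by blast
  then have "finite (revlex_core R (P2 idx n))"
    by (rule finite_subset) (simp add: finite_pts)
  then have compact: "compact_space ?X" by (rule compact_space_geom_realization)
  have hausdorff: "Hausdorff_space (nsphere (m - 1))"
    unfolding nsphere by (intro Hausdorff_space_subtopology) (simp add: Hausdorff_space_product_topology)
  have inj: "inj_on ?h (topspace ?X)"
  proof (rule inj_onI)
    fix f f' assume "f \<in> topspace ?X" "f' \<in> topspace ?X" and eq: "?h f = ?h f'"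
    then have f: "f \<in> core_functions" "f' \<in> core_functions" by (auto simp: topspace_core)
    note pos = proj_norm_pos[OF f(1)] proj_norm_pos[OF f(2)]
    \<comment> \<open>The l1-norm of \<open>?h g\<close> reveals the factor lost in the
      normalization, because that of \<open>proj g\<close> is always 2.\<close>
    have l1: "(\<Sum>k<m. \<bar>?h g k\<bar>) = 2 / proj_norm g" if "g \<in> core_functions" for g
      using proj_l1_norm[OF that] proj_norm_pos[OF that] by (simp flip: sum_divide_distrib)
    have "(\<Sum>k<m. \<bar>?h f k\<bar>) = (\<Sum>k<m. \<bar>?h f' k\<bar>)"
      by (intro sum.cong refl arg_cong[where f = abs] fun_cong[OF eq])
    then have "2 / proj_norm f = 2 / proj_norm f'"
      unfolding l1[OF f(1)] l1[OF f(2)] .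
    then have "proj_norm f = proj_norm f'" using pos by (simp add: field_simps)
    then have "proj f k = proj f' k" for k
      using fun_cong[OF eq, of k] pos by simp
    then show "f = f'" by (rule proj_inj[OF f])
  qed
  have "?h ` topspace ?X = topspace (nsphere (m - 1))"
  proof
    show "?h ` topspace ?X \<subseteq> topspace (nsphere (m - 1))"
      using sphere by (auto simp: topspace_core)
    show "topspace (nsphere (m - 1)) \<subseteq> ?h ` topspace ?X"
    proof
      fix y assume "y \<in> topspace (nsphere (m - 1))"
      then have y: "(\<Sum>k<m. (y k)\<^sup>2) = 1" "\<And>k. k \<ge> m \<Longrightarrow> y k = 0"
        unfolding topS by auto
      define L where "L = (\<Sum>k<m. \<bar>y k\<bar>)"
      have "L \<noteq> 0"
      proof
        assume "L = 0"
        then have "\<forall>k<m. y k = 0" by (simp add: L_def sum_nonneg_eq_0_iff)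
        then show False using y(1) by simp
      qed
      moreover have "0 \<le> L" by (simp add: L_def sum_nonneg)
      ultimately have L: "0 < L" by simp
      \<comment> \<open>Scaling by \<open>2 / L\<close> moves \<open>y\<close> to the l1-sphere of
        radius 2; since \<open>y\<close> has Euclidean norm 1, the normalization takes the preimage
        back to \<open>y\<close>.\<close>
      have "(\<Sum>k<m. \<bar>2 / L * y k\<bar>) = 2 / L * L"
        unfolding L_def sum_distrib_left using L by (simp add: abs_mult L_def)
      then obtain f where f: "f \<in> core_functions" "\<And>k. k < m \<Longrightarrow> proj f k = 2 / L * y k"
        using proj_surj[of "\<lambda>k. 2 / L * y k"] L by auto
      have "proj_norm f = sqrt ((2 / L)\<^sup>2 * (\<Sum>k<m. (y k)\<^sup>2))"
        unfolding proj_norm_def sum_distrib_left using f(2)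
        by (simp add: power_mult_distrib power_divide)
      then have "proj_norm f = 2 / L" using y(1) L by simp
      then have "?h f k = y k" for k
        using f(2)[of k] y(2)[of k] L by (cases "k < m") (auto simp: proj_def)
      then have "y = ?h f" by auto
      then show "y \<in> ?h ` topspace ?X" using f(1) by (auto simp: topspace_core)
    qed
  qed
  then have "homeomorphic_map ?X (nsphere (m - 1)) ?h"
    using cont compact hausdorff inj by (intro continuous_imp_homeomorphic_map)
  then show ?thesis using homeomorphic_map_imp_homeomorphic_space by blast
qed

end

theorem theorem5p5:
  fixes m n :: nat and idx :: "nat \<Rightarrow> 'n::finite" and R :: "((real ^ 'n) \<times> (real ^ 'n)) set"
  assumes m: "m \<ge> 1" and n: "n = 2 * m"
    and idx: "bij_betw idx {1..n} (UNIV :: 'n set)"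
    and tot: "strict_total_order_on (P2 idx n) R"
    and anti_chain: "\<And>i i'. 1 \<le> i \<Longrightarrow> i < i' \<Longrightarrow> i' \<le> m \<Longrightarrow>
           (xpt idx i' (n + 1 - i'), xpt idx i (n + 1 - i)) \<in> R"
    and anti_small: "\<And>i j h. 1 \<le> i \<Longrightarrow> i \<le> j \<Longrightarrow> j \<le> n \<Longrightarrow> i + j \<noteq> n + 1 \<Longrightarrow>
           1 \<le> h \<Longrightarrow> h \<le> m \<Longrightarrow> (xpt idx i j, xpt idx h (n + 1 - h)) \<in> R"
    and others: "\<And>i j h k. 1 \<le> i \<Longrightarrow> i \<le> j \<Longrightarrow> j \<le> n \<Longrightarrow> i + j \<noteq> n + 1 \<Longrightarrow>
           1 \<le> h \<Longrightarrow> h \<le> k \<Longrightarrow> k \<le> n \<Longrightarrow> h + k \<noteq> n + 1 \<Longrightarrow>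
           j - i < k - h \<Longrightarrow> (xpt idx i j, xpt idx h k) \<in> R"
  shows "geom_realization (revlex_core R (P2 idx n)) homeomorphic_space nsphere (m - 1)"
proof -
  interpret antidiagonal_revlex n idx m R
    by unfold_locales (fact assms)+
  show ?thesis by (rule core_homeomorphic_sphere)
qed

end
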